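(* Let $q\ge3$ be prime and let $S\subseteq\mathbb{F}_q$ with $|S|=\frac{q-1}{2}$ be such that the stabilizer of the vertex $(0,0)$ in $\mathrm{Aut}(G_S)$ equals $\{v\mapsto\lambda v:\lambda\in\mathbb{F}_q^*\}$. Then $\chi_D(G_S)=q+1$.
   Context: The graph $G_S$ has vertex set $\mathbb{F}_q^2$, and $u=(u_1,u_2)$, $v=(v_1,v_2)$ are adjacent iff $u_1\neq v_1$ and $(v_2-u_2)(v_1-u_1)^{-1}\in S$. A coloring is distinguishing if the only graph automorphism mapping every color class onto itself is the identity; $\chi_D(G)$ is the minimum number of colors of a proper distinguishing coloring of $G$. *)

theory Defs
  imports "HOL-Computational_Algebra.Primes" "HOL-Library.Cardinality"
begin

text \<open>The graph G_S on F_q^2. The field F_q (q prime) is modelled by a finite field type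
  'a whose cardinality is q.\<close>

definition GS_adj :: "'a::field set \<Rightarrow> 'a \<times> 'a \<Rightarrow> 'a \<times> 'a \<Rightarrow> bool" where
  "GS_adj S u v \<longleftrightarrow> fst u \<noteq> fst v \<and> (snd v - snd u) * inverse (fst v - fst u) \<in> S"

definition GS_aut :: "'a::field set \<Rightarrow> ('a \<times> 'a \<Rightarrow> 'a \<times> 'a) \<Rightarrow> bool" where
  "GS_aut S f \<longleftrightarrow> bij f \<and> (\<forall>u v. GS_adj S u v \<longleftrightarrow> GS_adj S (f u) (f v))"

definition proper_col :: "('v \<Rightarrow> 'v \<Rightarrow> bool) \<Rightarrow> ('v \<Rightarrow> nat) \<Rightarrow> bool" where
  "proper_col adj c \<longleftrightarrow> (\<forall>u v. adj u v \<longrightarrow> c u \<noteq> c v)"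

definition distinguishing_col :: "(('v \<Rightarrow> 'v) \<Rightarrow> bool) \<Rightarrow> ('v \<Rightarrow> nat) \<Rightarrow> bool" where
  "distinguishing_col aut c \<longleftrightarrow>
     (\<forall>f. aut f \<and> (\<forall>i. f ` {v. c v = i} = {v. c v = i}) \<longrightarrow> f = id)"

definition chi_D_GS :: "'a::field set \<Rightarrow> nat" where
  "chi_D_GS S = (LEAST k. \<exists>c. (\<forall>v. c v < k) \<and> proper_col (GS_adj S) c
                              \<and> distinguishing_col (GS_aut S) c)"

end

theory Submission
  imports Defs "HOL-Computational_Algebra.Polynomial"
begin

text \<open>
  Write \<open>q = 2 r + 1\<close>. For the upper bound, colour \<open>(x, y)\<close> by \<open>x\<close> and give the origin a colour of
  its own: an automorphism respecting this is a homothety fixing all abscissae.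

  For the lower bound, every line with slope in \<open>S\<close> is a clique of size \<open>q\<close>, so each class of a
  proper \<open>q\<close>-colouring meets each such line exactly once. Fixing \<open>s0 \<in> S\<close> and the coordinates
  \<open>X = y - s0 * x\<close>, \<open>Y = x\<close>, a class is the graph of a function \<open>f\<close> for which \<open>X + m * f X\<close> is a
  permutation for the \<open>r\<close> values \<open>m = s0 - s\<close>. Hence the moments \<open>\<Sum>x. x^j * f x^i\<close> with
  \<open>i + j < r\<close> vanish. As in the theorems of Redei and Lovasz--Schrijver this forces \<open>f\<close> to be
  affine or its graph to lie on two lines. In the second case a counting argument shows that \<open>S\<close> is
  invariant under a linear map that is not a homothety, against the hypothesis on the stabilizer.
  So all classes are lines; being disjoint they are parallel, and a translation along them preserves
  the colouring. The moment argument needs \<open>q \<ge> 11\<close>, but for \<open>|S| \<le> 3\<close> some nonscalar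
  linear involution always preserves \<open>S\<close>.
\<close>

subsection \<open>Power sums over finite fields\<close>

lemma of_nat_CARD_eq_0: "of_nat CARD('a) = (0 :: 'a::{comm_ring_1,finite})"
proof -
  have "(\<Sum>x\<in>UNIV. x + 1 :: 'a) = (\<Sum>x\<in>UNIV. x)"
    by (rule sum.reindex_bij_witness[of _ "\<lambda>x. x - 1" "\<lambda>x. x + 1"]) auto
  thus ?thesis by (simp add: sum.distrib)
qed

lemma of_nat_eq_0_iff_prime_CARD:
  assumes "prime CARD('a::{field,finite})"
  shows "of_nat n = (0 :: 'a) \<longleftrightarrow> CARD('a) dvd n"
proof -
  have "CHAR('a) dvd CARD('a)"
    using of_nat_CARD_eq_0[where ?'a = 'a] by (simp add: of_nat_eq_0_iff_char_dvd)
  moreover have "CHAR('a) \<noteq> 1"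
    using of_nat_eq_0_iff_char_dvd[of 1, where ?'a = 'a] by auto
  ultimately have "CHAR('a) = CARD('a)" using assms by (auto simp: prime_nat_iff)
  thus ?thesis by (simp add: of_nat_eq_0_iff_char_dvd)
qed

text \<open>The first \<open>q\<close> multiples of 1 are distinct, so they exhaust the field. This
  lets a property be carried to every element by repeated steps of a fixed nonzero size.\<close>

lemma surj_of_nat_prime_CARD:
  assumes "prime CARD('a::{field,finite})"
  shows "\<exists>n. x = (of_nat n :: 'a)"
proof -
  have "inj_on (of_nat :: nat \<Rightarrow> 'a) {..<CARD('a)}"
  proof (rule linorder_inj_onI)
    fix m n assume "m < n" "m \<in> {..<CARD('a)}" "n \<in> {..<CARD('a)}"
    hence "\<not> CARD('a) dvd n - m" by (auto dest!: dvd_imp_le)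
    hence "of_nat (n - m) \<noteq> (0::'a)" by (simp add: of_nat_eq_0_iff_prime_CARD assms)
    thus "of_nat m \<noteq> (of_nat n :: 'a)" using \<open>m < n\<close> by (simp add: of_nat_diff)
  qed auto
  hence "of_nat ` {..<CARD('a)} = (UNIV :: 'a set)"
    by (intro card_subset_eq) (auto simp: card_image)
  thus ?thesis by blast
qed

lemma power_CARD_minus_1:
  fixes x :: "'a::{field,finite}"
  assumes "x \<noteq> 0"
  shows "x ^ (CARD('a) - 1) = 1"
proof -
  have "(\<Prod>y\<in>UNIV-{0}. x * y) = (\<Prod>y\<in>UNIV-{0}. y)"
    by (rule prod.reindex_bij_witness[of _ "\<lambda>y. y / x" "\<lambda>y. x * y"]) (use assms in auto)
  hence "x ^ (CARD('a) - 1) * \<Prod>(UNIV-{0}) = 1 * \<Prod>(UNIV-{0::'a})"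
    by (simp add: prod.distrib)
  thus ?thesis by (subst (asm) mult_cancel_right) auto
qed

lemma power_CARD:
  fixes x :: "'a::{field,finite}"
  shows "x ^ CARD('a) = x"
proof (cases "x = 0")
  case False
  have "x ^ CARD('a) = x * x ^ (CARD('a) - 1)"
    by (metis finite_UNIV_card_ge_0 finite_class.finite_UNIV power_eq_if less_numeral_extra(3))
  with False show ?thesis by (simp add: power_CARD_minus_1 del: One_nat_def)
qed auto

lemma sum_power_CARD_minus_1:
  assumes "CARD('a::{field,finite}) > 1"
  shows "(\<Sum>x\<in>UNIV. x ^ (CARD('a) - 1)) = (-1 :: 'a)"
proof -
  have "(\<Sum>x\<in>UNIV. x ^ (CARD('a) - 1)) = (\<Sum>x\<in>UNIV. (1::'a) - (if x = (0::'a) then 1 else 0))"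
    using assms by (intro sum.cong refl) (auto simp: power_CARD_minus_1 simp del: One_nat_def)
  also have "\<dots> = -1"
    by (simp add: sum_subtractf of_nat_CARD_eq_0)
  finally show ?thesis .
qed

text \<open>For \<open>n > 0\<close> the polynomial \<open>x^n - 1\<close> has too few roots to
  vanish at all nonzero elements, so some \<open>t\<close> has \<open>t^n \<noteq> 1\<close>;
  substituting \<open>t * x\<close> multiplies the sum by \<open>t^n\<close>. For
  \<open>n = 0\<close> the sum is \<open>q\<close> copies of 1.\<close>

lemma sum_power_eq_0:
  assumes "n < CARD('a::{field,finite}) - 1"
  shows "(\<Sum>x\<in>UNIV. x ^ n) = (0 :: 'a)"
proof (cases "n = 0")
  case True
  thus ?thesis by (simp add: of_nat_CARD_eq_0)
next
  case False
  have "\<exists>t::'a. t \<noteq> 0 \<and> t ^ n \<noteq> 1"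
  proof (rule ccontr)
    assume "\<not> ?thesis"
    hence "UNIV - {0} \<subseteq> {x::'a. poly (monom 1 n - 1) x = 0}"
      by (auto simp: poly_monom)
    hence "CARD('a) - 1 \<le> card {x::'a. poly (monom 1 n - 1) x = 0}"
      using card_mono[of "{x::'a. poly (monom 1 n - 1) x = 0}" "UNIV - {0}"] by simp
    also have "monom (1::'a) n - 1 \<noteq> 0"
    proof
      assume "monom (1::'a) n - 1 = 0"
      hence "poly (monom (1::'a) n - 1) 0 = 0" by simp
      thus False using False by (simp add: poly_monom power_0_left)
    qed
    hence "card {x::'a. poly (monom 1 n - 1) x = 0} \<le> degree (monom (1::'a) n - 1)"
      by (rule card_poly_roots_bound)
    also have "\<dots> \<le> n"
      by (intro degree_diff_le degree_monom_le) auto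
    finally show False using assms by simp
  qed
  then obtain t :: 'a where t: "t \<noteq> 0" "t ^ n \<noteq> 1" by blast
  have "(\<Sum>x\<in>UNIV. (t * x) ^ n) = (\<Sum>x\<in>UNIV. x ^ n)"
    by (rule sum.reindex_bij_witness[of _ "\<lambda>x. x / t" "\<lambda>x. t * x"]) (use t in auto)
  hence "t ^ n * (\<Sum>x\<in>UNIV. x ^ n) = 1 * (\<Sum>x\<in>UNIV. x ^ n)"
    by (simp add: power_mult_distrib sum_distrib_left)
  with t show ?thesis by (subst (asm) mult_cancel_right) auto
qed

text \<open>Below \<open>2 * (q - 1)\<close> the only exponent whose power sum is nonzero is
  \<open>q - 1\<close>, where it is -1; larger exponents are first reduced by
  \<open>x^q = x\<close>.\<close>

lemma sum_poly_UNIV: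
  fixes h :: "'a::{field,finite} poly"
  assumes "degree h < 2 * (CARD('a) - 1)"
  shows "(\<Sum>x\<in>UNIV. poly h x) = - coeff h (CARD('a) - 1)"
proof -
  let ?q = "CARD('a)"
  from assms have q: "?q > 1" by simp
  have pw: "(\<Sum>x\<in>UNIV. x ^ i) = (if i = ?q - 1 then -1 else 0 :: 'a)" if "i < 2 * (?q - 1)" for i
  proof (cases "i < ?q")
    case True
    thus ?thesis using q by (auto simp: sum_power_CARD_minus_1 simp del: One_nat_def intro!: sum_power_eq_0)
  next
    case False
    have "x ^ i = x ^ (i - (?q - 1))" for x :: 'a
    proof -
      have "x ^ i = x ^ ?q * x ^ (i - ?q)"
        using False by (simp flip: power_add)
      also have "\<dots> = x ^ Suc (i - ?q)" by (simp add: power_CARD)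
      also have "Suc (i - ?q) = i - (?q - 1)" using False q by linarith
      finally show ?thesis .
    qed
    moreover have "i - (?q - 1) < ?q - 1" using that by linarith
    ultimately show ?thesis using False q by (simp add: sum_power_eq_0)
  qed
  have "(\<Sum>x\<in>UNIV. poly h x) = (\<Sum>i\<le>degree h. coeff h i * (\<Sum>x\<in>UNIV. x ^ i))"
    unfolding poly_altdef sum_distrib_left by (rule sum.swap)
  also have "\<dots> = (\<Sum>i\<le>degree h. if i = ?q - 1 then - coeff h i else 0)"
    using assms by (intro sum.cong refl) (auto simp: pw)
  also have "\<dots> = - coeff h (?q - 1)"
    by (auto simp: coeff_eq_0)
  finally show ?thesis .
qed

text \<open>By Fermat, \<open>1 - (x - a)^(q - 1)\<close> is the indicator function of the point
  \<open>a\<close>.\<close>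

lemma exists_interpolating_poly:
  fixes f :: "'a::{field,finite} \<Rightarrow> 'a"
  shows "\<exists>p. degree p \<le> CARD('a) - 1 \<and> (\<forall>x. poly p x = f x)"
proof (intro exI conjI allI)
  let ?p = "\<Sum>a\<in>UNIV. smult (f a) (1 - [:-a, 1:] ^ (CARD('a) - 1))"
  show "degree ?p \<le> CARD('a) - 1"
    by (intro degree_sum_le finite degree_smult_le[THEN order_trans] degree_diff_le
         degree_power_le[THEN order_trans]) auto
  fix x
  have "CARD('a) > 1"
    using card_mono[of UNIV "{0, 1::'a}"] by simp
  hence "poly ?p x = (\<Sum>a\<in>UNIV. if a = x then f a else 0)"
    unfolding poly_sum by (intro sum.cong refl) (auto simp: power_CARD_minus_1 simp del: One_nat_def)
  thus "poly ?p x = f x" by simp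
qed

subsection \<open>Vanishing moments\<close>

lemma sum_power_mult_poly:
  fixes h :: "'a::{field,finite} poly"
  assumes "j \<le> CARD('a) - 1" "j + degree h < 2 * (CARD('a) - 1)"
  shows "(\<Sum>x\<in>UNIV. x ^ j * poly h x) = - coeff h (CARD('a) - 1 - j)"
proof -
  have "degree (monom 1 j * h) \<le> j + degree h"
    by (rule order_trans[OF degree_mult_le]) (simp add: degree_monom_eq)
  with assms(2) have "degree (monom 1 j * h) < 2 * (CARD('a) - 1)" by linarith
  from sum_poly_UNIV[OF this] assms(1) show ?thesis
    by (simp add: poly_monom coeff_monom_mult)
qed

text \<open>The power \<open>j\<close> moves the leading coefficient of \<open>h\<close> to degree
  \<open>q - 1\<close>, the one degree that the sum detects. All contradictions with vanishing
  moments arise this way.\<close>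

lemma sum_power_mult_poly_neq_0:
  fixes h :: "'a::{field,finite} poly"
  assumes "h \<noteq> 0" "j + degree h = CARD('a) - 1"
  shows "(\<Sum>x\<in>UNIV. x ^ j * poly h x) \<noteq> 0"
proof -
  have "CARD('a) > 1"
    using card_mono[of UNIV "{0, 1::'a}"] by simp
  hence "j + degree h < 2 * (CARD('a) - 1)" "j \<le> CARD('a) - 1" "CARD('a) - 1 - j = degree h"
    using assms(2) by linarith+
  hence "(\<Sum>x\<in>UNIV. x ^ j * poly h x) = - lead_coeff h"
    by (subst sum_power_mult_poly) simp_all
  with assms(1) show ?thesis by simp
qed

text \<open>Equivalently, every bivariate polynomial of total degree below \<open>r\<close> sums to
  zero over the graph of \<open>f\<close>.\<close>

definition moments_vanish :: "('a::{field,finite} \<Rightarrow> 'a) \<Rightarrow> nat \<Rightarrow> bool" where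
  "moments_vanish f r \<longleftrightarrow> (\<forall>i j. i + j < r \<longrightarrow> (\<Sum>x\<in>UNIV. x ^ j * f x ^ i) = 0)"

lemma moments_vanishD:
  "moments_vanish f r \<Longrightarrow> i + j < r \<Longrightarrow> (\<Sum>x\<in>UNIV. x ^ j * f x ^ i) = 0"
  by (auto simp: moments_vanish_def)

text \<open>For fixed \<open>k = i + j\<close> the sum of \<open>(x + m * f x)^k\<close> is a
  polynomial in \<open>m\<close> of degree at most \<open>k\<close>. It vanishes at the more than
  \<open>k\<close> elements of \<open>M\<close>, hence identically, and its coefficients are
  binomial multiples of the moments.\<close>

lemma moments_vanish_if_permutations:
  fixes f :: "'a::{field,finite} \<Rightarrow> 'a"
  assumes "prime CARD('a)" and M: "\<And>m. m \<in> M \<Longrightarrow> inj (\<lambda>x. x + m * f x)"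
    and "card M < CARD('a)"
  shows "moments_vanish f (card M)"
  unfolding moments_vanish_def
proof (intro allI impI)
  fix i j assume ij: "i + j < card M"
  define k where "k = i + j"
  define h where "h = (\<Sum>l\<le>k. monom (of_nat (k choose l) * (\<Sum>x\<in>UNIV. x ^ (k - l) * f x ^ l)) l)"
  have h_M: "poly h m = 0" if "m \<in> M" for m
  proof -
    have "poly h m = (\<Sum>l\<le>k. \<Sum>x\<in>UNIV. of_nat (k choose l) * (m * f x) ^ l * x ^ (k - l))"
      by (simp add: h_def poly_sum poly_monom sum_distrib_left sum_distrib_right
          power_mult_distrib mult_ac)
    also have "\<dots> = (\<Sum>x\<in>UNIV. \<Sum>l\<le>k. of_nat (k choose l) * (m * f x) ^ l * x ^ (k - l))"
      by (rule sum.swap)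
    also have "\<dots> = (\<Sum>x\<in>UNIV. (m * f x + x) ^ k)"
      by (simp add: binomial_ring)
    also have "\<dots> = (\<Sum>x\<in>UNIV. (x + m * f x) ^ k)"
      by (simp add: add.commute)
    also have "\<dots> = (\<Sum>y\<in>UNIV. y ^ k)"
      using M[OF that] by (intro sum.reindex_bij_betw) (auto simp: bij_betw_def finite_UNIV_inj_surj)
    also have "\<dots> = 0"
      using ij assms(3) by (intro sum_power_eq_0) (auto simp: k_def)
    finally show ?thesis .
  qed
  have "degree h \<le> k"
    unfolding h_def by (intro degree_sum_le) (auto intro: degree_monom_le[THEN order_trans])
  hence "h = 0"
    using h_M ij by (intro poly_eqI_degree[of M]) (auto simp: k_def)
  hence "coeff h i = 0" by simp
  also have "coeff h i = of_nat (k choose i) * (\<Sum>x\<in>UNIV. x ^ j * f x ^ i)"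
    by (simp add: h_def coeff_sum k_def)
  finally have "of_nat (k choose i) * (\<Sum>x\<in>UNIV. x ^ j * f x ^ i) = 0" .
  \<comment> \<open>Since \<open>k\<close> is below the prime \<open>q\<close>, the binomial
    coefficient is invertible in the field.\<close>
  moreover have "\<not> CARD('a) dvd (k choose i)"
  proof
    assume "CARD('a) dvd (k choose i)"
    also have "(k choose i) dvd fact k"
      by (metis binomial_fact_lemma dvd_triv_right k_def le_add1)
    finally have "CARD('a) \<le> k" using assms(1) by (simp add: prime_dvd_fact_iff)
    with ij assms(3) show False by (simp add: k_def)
  qed
  ultimately show "(\<Sum>x\<in>UNIV. x ^ j * f x ^ i) = 0"
    by (simp add: of_nat_eq_0_iff_prime_CARD assms(1))
qed

text \<open>Subtracting an affine function does not raise total degrees. The induction expands one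
  factor of the sheared function at a time, so it runs over mixed moments in \<open>x\<close>,
  \<open>f x\<close> and \<open>?F x\<close>.\<close>

lemma moments_vanish_shear:
  assumes "moments_vanish f r"
  shows "moments_vanish (\<lambda>x. f x - (a * x + b)) r"
proof -
  let ?F = "\<lambda>x. f x - (a * x + b)"
  have "(\<Sum>x\<in>UNIV. x ^ j * f x ^ i * ?F x ^ l) = 0" if "i + j + l < r" for i j l
    using that
  proof (induction l arbitrary: i j)
    case 0
    thus ?case using assms by (simp add: moments_vanish_def)
  next
    case (Suc l)
    have "(\<Sum>x\<in>UNIV. x ^ j * f x ^ i * ?F x ^ Suc l) =
       (\<Sum>x\<in>UNIV. x ^ j * f x ^ Suc i * ?F x ^ l - a * (x ^ Suc j * f x ^ i * ?F x ^ l)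
          - b * (x ^ j * f x ^ i * ?F x ^ l))"
      by (intro sum.cong refl) (simp add: algebra_simps)
    also have "\<dots> = 0"
      using Suc.IH[of "Suc i" j] Suc.IH[of i "Suc j"] Suc.IH[of i j] Suc.prems
      by (simp only: sum_subtractf sum_distrib_left[symmetric]) simp
    finally show ?case .
  qed
  from this[of 0] show ?thesis by (simp add: moments_vanish_def add.commute)
qed

section \<open>Degree restrictions on the interpolating polynomial\<close>

text \<open>For \<open>d = degree p\<close>, the product \<open>x^(2*r - l*d) * p^l\<close> has
  degree \<open>q - 1\<close>, so its sum is nonzero; it is a vanishing moment as soon as
  \<open>l * (d - 1) > r\<close>. The degrees 2 and \<open>r + 1\<close> are the borderline cases of
  equality, with \<open>l = r\<close> and \<open>l = 1\<close>.\<close>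

lemma degree_cases_if_moments_vanish:
  fixes p :: "'a::{field,finite} poly"
  assumes mv: "moments_vanish (poly p) r" and q: "CARD('a) = 2 * r + 1" and r: "r \<ge> 5"
    and deg: "degree p \<le> 2 * r"
  shows "degree p \<le> 2 \<or> degree p = r + 1"
proof (rule ccontr)
  define d where "d = degree p"
  assume neg: "\<not> ?thesis"
  hence d3: "d \<ge> 3" by (simp add: d_def)
  have "p \<noteq> 0" using neg by auto
  have "d \<le> r + 1"
  \<comment> \<open>Degrees above \<open>r + 1\<close> are excluded already by the first power of
    \<open>p\<close>.\<close>
  proof (rule ccontr)
    assume *: "\<not> d \<le> r + 1"
    have "(\<Sum>x\<in>UNIV. x ^ (2*r-d) * poly p x) \<noteq> 0"
      using deg by (intro sum_power_mult_poly_neq_0) (auto simp: q d_def \<open>p \<noteq> 0\<close>)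
    moreover have "(\<Sum>x\<in>UNIV. x ^ (2*r-d) * poly p x ^ 1) = 0"
      using * deg by (intro moments_vanishD[OF mv]) (auto simp: d_def)
    ultimately show False by simp
  qed
  hence "d \<le> r" using neg by (auto simp: d_def)
  define l where "l = 2 * r div d"
  have ld: "l * d \<le> 2 * r" by (simp add: l_def)
  have ld': "2 * r < (l + 1) * d"
    using d3 by (simp add: l_def) (metis One_nat_def add.commute div_mult_mod_eq mod_less_divisor
      nat_add_left_cancel_less not_numeral_le_zero bot_nat_0.not_eq_extremum)
  have l2: "l \<ge> 2"
    using \<open>d \<le> r\<close> d3 unfolding l_def by (subst less_eq_div_iff_mult_less_eq) auto
  \<comment> \<open>The claim amounts to \<open>l * (d - 1) > r\<close>. If
    \<open>2 * (d - 1) > r\<close>, then \<open>l \<ge> 2\<close> suffices. Otherwise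
    \<open>l\<close> is eliminated between \<open>l * (d - 1) \<le> r\<close> and the maximality of
    \<open>l\<close>; this forces \<open>d = 3\<close> and then \<open>r \<le> 4\<close>.\<close>
  have key: "2 * r - l * d + l < r"
  proof -
    have "l * d > r + l"
    proof (cases "2 * (d - 1) \<le> r")
      case False
      obtain e where e: "d = Suc e" using d3 by (cases d) auto
      have "l * e \<ge> 2 * e" using l2 by (intro mult_right_mono) auto
      moreover have "2 * e > r" using False by (simp add: e)
      ultimately have "l * e > r" by linarith
      thus ?thesis by (simp add: e)
    next
      case True
      show ?thesis
      proof (rule ccontr)
        assume *: "\<not> l * d > r + l"
        obtain e where e: "d = e + 3" using d3 by (metis add.commute le_Suc_ex)
        from * have "l * (e + 2) \<le> r" by (simp add: e algebra_simps)
        hence "l * (e + 2) * (e + 3) \<le> r * (e + 3)" by (rule mult_right_mono) auto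
        moreover have "(2 * r + 1) * (e + 2) \<le> (l + 1) * (e + 3) * (e + 2)"
          using ld' unfolding e by (intro mult_right_mono) auto
        ultimately have 1: "r * (e + 1) + (e + 2) \<le> (e + 3) * (e + 2)"
          by (simp add: algebra_simps)
        have "2 * (e + 2) * (e + 1) \<le> r * (e + 1)"
          using True unfolding e by (intro mult_right_mono) auto
        hence "2 * (e + 2) * (e + 1) + (e + 2) \<le> (e + 3) * (e + 2)" using 1 by linarith
        hence "e = 0" by (cases e) (auto simp: algebra_simps)
        with 1 r show False by simp
      qed
    qed
    thus ?thesis using ld by linarith
  qed
  have "(\<Sum>x\<in>UNIV. x ^ (2*r-l*d) * poly (p ^ l) x) \<noteq> 0"
    using ld by (intro sum_power_mult_poly_neq_0) (auto simp: q d_def \<open>p \<noteq> 0\<close> degree_power_eq)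
  moreover have "(\<Sum>x\<in>UNIV. x ^ (2*r-l*d) * poly p x ^ l) = 0"
    using key by (intro moments_vanishD[OF mv]) auto
  ultimately show False by simp
qed

text \<open>For \<open>m \<noteq> 0\<close> the map is a quadratic polynomial, hence symmetric under
  a reflection \<open>x \<mapsto> s - x\<close>, and so not injective.\<close>

lemma quadratic_permutation_imp_trivial:
  fixes p :: "'a::{field,finite} poly"
  assumes "degree p = 2" "inj (\<lambda>x. x + m * poly p x)" "(2::'a) \<noteq> 0"
  shows "m = 0"
proof (rule ccontr)
  assume "m \<noteq> 0"
  define a b c where "a = coeff p 2" and "b = coeff p 1" and "c = coeff p 0"
  have "a \<noteq> 0" using assms(1) by (metis a_def degree_0 leading_coeff_0_iff zero_neq_numeral)
  have p: "poly p x = a * x ^ 2 + b * x + c" for x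
    by (simp add: poly_altdef assms(1) a_def b_def c_def numeral_2_eq_2)
  define s where "s = - (1 + m * b) / (m * a)"
  \<comment> \<open>Any point other than the centre of the reflection serves.\<close>
  define x :: 'a where "x = (if s = 0 then 1 else 0)"
  have "(s - x) + m * poly p (s - x) = x + m * poly p x + (s - 2 * x) * (1 + m * b + m * a * s)"
    by (simp add: p power2_eq_square algebra_simps)
  also have "1 + m * b + m * a * s = 0"
    using \<open>m \<noteq> 0\<close> \<open>a \<noteq> 0\<close> by (simp add: s_def)
  finally have "s - x = x"
    using injD[OF assms(2), of "s - x" x] by simp
  thus False using assms(3) by (auto simp: x_def split: if_splits)
qed

text \<open>The moments with \<open>i = 2\<close> kill the coefficients of \<open>p^2\<close> in
  degrees \<open>r + 3\<close> to \<open>2 * r\<close>. The two terms above them drop to degrees 1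
  and 2 by \<open>x^q = x\<close>.\<close>

lemma square_reduction:
  fixes p :: "'a::{field,finite} poly"
  assumes mv: "moments_vanish (poly p) r" and q: "CARD('a) = 2 * r + 1" and r: "r \<ge> 5"
    and deg: "degree p = r + 1"
  shows "\<exists>g. degree g \<le> r + 2 \<and> (\<forall>x. poly p x ^ 2 = poly g x)"
proof -
  have zero: "coeff (p ^ 2) n = 0" if "r + 3 \<le> n" "n \<le> 2 * r" for n
  proof -
    have "degree (p ^ 2) \<le> 2 * r + 2" using degree_power_le[of p 2] deg by simp
    hence "(\<Sum>x\<in>UNIV. x ^ (2 * r - n) * poly (p ^ 2) x) = - coeff (p ^ 2) n"
      using that r by (subst sum_power_mult_poly) (auto simp: q)
    moreover have "(\<Sum>x\<in>UNIV. x ^ (2 * r - n) * poly p x ^ 2) = 0"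
      using that by (intro moments_vanishD[OF mv]) auto
    ultimately show ?thesis by simp
  qed
  define A B where "A = coeff (p ^ 2) (2 * r + 1)" and "B = coeff (p ^ 2) (2 * r + 2)"
  define g where "g = p ^ 2 - monom A (2 * r + 1) - monom B (2 * r + 2) + monom A 1 + monom B 2"
  have "coeff g i = 0" if "i > r + 2" for i
  proof -
    have "coeff (p ^ 2) i = 0" if "i > 2 * r + 2"
      using that degree_power_le[of p 2] deg by (intro coeff_eq_0) simp
    moreover have "i \<le> 2 * r \<or> i = 2 * r + 1 \<or> i = 2 * r + 2 \<or> i > 2 * r + 2" by linarith
    ultimately show ?thesis
      using that zero[of i] by (auto simp: g_def A_def B_def)
  qed
  hence "degree g \<le> r + 2" by (intro degree_le) auto
  moreover have "poly p x ^ 2 = poly g x" for x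
  proof -
    have "x ^ (2 * r + 1) = x" using power_CARD[of x] by (simp add: q)
    moreover from this have "x ^ (2 * r + 2) = x ^ 2" by (simp add: power2_eq_square)
    ultimately show ?thesis
      by (simp add: g_def poly_monom del: power_Suc)
  qed
  ultimately show ?thesis by blast
qed

text \<open>Completing the square removes the terms of degree \<open>r + 2\<close> and \<open>r + 1\<close> of the reduced
  square; the third and fourth moments of the sheared function then rule out degrees above two.\<close>

lemma sheared_square_is_quadratic:
  fixes p :: "'a::{field,finite} poly"
  assumes mv: "moments_vanish (poly p) r" and q: "CARD('a) = 2 * r + 1" and r: "r \<ge> 5"
    and deg: "degree p = r + 1" and two: "(2::'a) \<noteq> 0"
  shows "\<exists>a b g. degree g \<le> 2 \<and> (\<forall>x. (poly p x - (a * x + b)) ^ 2 = poly g x)"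
proof -
  obtain g0 where g0: "degree g0 \<le> r + 2" "\<And>x. poly p x ^ 2 = poly g0 x"
    using square_reduction[OF mv q r deg] by blast
  have lc: "coeff p (Suc r) \<noteq> 0" using deg by (metis leading_coeff_0_iff Suc_eq_plus1 degree_0 nat.distinct(1))
  define al where "al = coeff g0 (r + 2) / coeff p (r + 1)"
  define g1 where "g1 = g0 - monom al 1 * p"
  have "coeff g1 i = 0" if "i > r + 1" for i
  proof (cases "i = r + 2")
    case True
    thus ?thesis using lc by (simp add: g1_def al_def coeff_monom_mult)
  next
    case False
    with that have "i > r + 2" by simp
    hence "coeff g0 i = 0" "coeff p (i - 1) = 0" using g0(1) deg by (auto intro!: coeff_eq_0)
    thus ?thesis by (simp add: g1_def coeff_monom_mult)
  qed
  note g1 = this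
  define be where "be = coeff g1 (r + 1) / coeff p (r + 1)"
  define g2 where "g2 = g1 - smult be p"
  have "coeff g2 i = 0" if "i > r" for i
  proof (cases "i = r + 1")
    case True
    thus ?thesis using lc by (simp add: g2_def be_def)
  next
    case False
    with that have "i > r + 1" by simp
    thus ?thesis using g1[of i] deg by (simp add: g2_def coeff_eq_0)
  qed
  hence "degree g2 \<le> r" by (intro degree_le) auto
  \<comment> \<open>As functions, \<open>p^2 = g2 + (al * x + be) * p\<close>, so the square is
    completed by half of the linear factor.\<close>
  define a b where "a = al / 2" and "b = be / 2"
  define L where "L = [:b, a:]"
  have degL: "degree L \<le> 1" by (simp add: L_def)
  define p' where "p' = p - L"
  define g where "g = g2 + L ^ 2"
  have "degree (L ^ 2) \<le> r"
    using degree_power_le[of L 2] degL r by linarith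
  with \<open>degree g2 \<le> r\<close> have deg_g: "degree g \<le> r"
    unfolding g_def by (intro degree_add_le)
  have g: "poly p' x ^ 2 = poly g x" for x
  proof -
    have "al = 2 * a" "be = 2 * b" using two by (auto simp: a_def b_def)
    thus ?thesis
      by (simp add: g_def g2_def g1_def p'_def L_def poly_monom power2_diff g0(2)[symmetric])
         (simp add: algebra_simps power2_eq_square)
  qed
  have deg_p': "degree p' = r + 1"
    unfolding p'_def using degree_add_eq_left[of "- L" p] degL deg r by simp
  have p': "poly p' x = poly p x - (a * x + b)" for x
    by (simp add: p'_def L_def algebra_simps)
  have mv': "moments_vanish (poly p') r"
    unfolding p' using moments_vanish_shear[OF mv] .
  have "degree g \<le> 2"
  proof (rule ccontr)
    assume *: "\<not> degree g \<le> 2"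
    hence nz: "g \<noteq> 0" "p' \<noteq> 0" using deg_p' by auto
    show False
    \<comment> \<open>If the degree is \<open>r\<close>, the fourth moment is the sum of
      \<open>g^2\<close>, of degree \<open>q - 1\<close>, and \<open>4 < r\<close>. If it lies
      strictly between 2 and \<open>r\<close>, a third moment is a sum with \<open>p' * g\<close>,
      and the exponent of \<open>x\<close> that completes the degree to \<open>q - 1\<close> is
      below \<open>r - 3\<close>.\<close>
    proof (cases "degree g = r")
      case True
      have "(\<Sum>x\<in>UNIV. x ^ 0 * poly (g ^ 2) x) \<noteq> 0"
        using nz True by (intro sum_power_mult_poly_neq_0) (auto simp: q degree_power_eq)
      moreover have "(\<Sum>x\<in>UNIV. x ^ 0 * poly p' x ^ 4) = 0"
        using r by (intro moments_vanishD[OF mv']) auto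
      moreover have "poly p' x ^ 4 = poly (g ^ 2) x" for x
        by (simp flip: g power_mult)
      ultimately show False by simp
    next
      case False
      have "(\<Sum>x\<in>UNIV. x ^ (r - 1 - degree g) * poly (p' * g) x) \<noteq> 0"
        using nz False deg_g by (intro sum_power_mult_poly_neq_0) (auto simp: q degree_mult_eq deg_p')
      moreover have "(\<Sum>x\<in>UNIV. x ^ (r - 1 - degree g) * poly p' x ^ 3) = 0"
        using * False deg_g by (intro moments_vanishD[OF mv']) auto
      moreover have "poly p' x ^ 3 = poly (p' * g) x" for x
        by (simp add: power3_eq_cube power2_eq_square flip: g)
      ultimately show False by simp
    qed
  qed
  with g p' show ?thesis by metis
qed

text \<open>The sum of \<open>g^r\<close> is evaluated twice: from its coefficient of degree
  \<open>q - 1\<close>, and from \<open>F x^(q - 1) = 1\<close> wherever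
  \<open>F x \<noteq> 0\<close>. Hence the number of zeros of \<open>g\<close> equals
  \<open>a^r\<close> in the field, which leaves only a double root or a constant.\<close>

lemma quadratic_square_valued:
  fixes g :: "'a::{field,finite} poly"
  assumes "prime CARD('a)" and q: "CARD('a) = 2 * r + 1" and r: "r \<ge> 2"
    and deg: "degree g \<le> 2" and g: "\<And>x. F x ^ 2 = poly g x"
  shows "(\<exists>d x0. \<forall>x. poly g x = (d * (x - x0)) ^ 2) \<or> (\<exists>d. \<forall>x. poly g x = d ^ 2)"
proof -
  define a b c where "a = coeff g 2" and "b = coeff g 1" and "c = coeff g 0"
  have pg: "poly g x = a * x ^ 2 + b * x + c" for x
  proof -
    have "poly g x = (\<Sum>i\<le>2. coeff g i * x ^ i)"
      unfolding poly_altdef using deg by (intro sum.mono_neutral_left) (auto simp: coeff_eq_0)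
    thus ?thesis by (simp add: a_def b_def c_def numeral_2_eq_2 add_ac)
  qed
  define Z where "Z = {x. poly g x = 0}"
  have Z: "of_nat (card Z) = a ^ r"
  proof -
    have "degree (g ^ r) \<le> 2 * r"
      using order_trans[OF degree_power_le[of g r] mult_right_mono[OF deg, of r]] by (simp only: zero_le)
    hence "(\<Sum>x\<in>UNIV. poly (g ^ r) x) = - coeff (g ^ r) (2 * r)"
      using r sum_poly_UNIV[of "g ^ r"] by (simp add: q)
    also have "coeff (g ^ r) (2 * r) = a ^ r"
    proof (cases "degree g = 2")
      case True
      hence "degree (g ^ r) = 2 * r" by (subst degree_power_eq) auto
      thus ?thesis using lead_coeff_power[of g r] True by (simp add: a_def)
    next
      case False
      hence "degree g < 2" "a = 0" using deg by (auto simp: a_def coeff_eq_0)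
      have "degree (g ^ r) < 2 * r"
        using order_trans[OF degree_power_le[of g r] mult_right_mono[of "degree g" 1 r]]
          \<open>degree g < 2\<close> r by simp
      thus ?thesis using \<open>a = 0\<close> r by (simp add: coeff_eq_0)
    qed
    finally have 1: "(\<Sum>x\<in>UNIV. poly (g ^ r) x) = - (a ^ r)" .
    have "(\<Sum>x\<in>UNIV. poly (g ^ r) x) = (\<Sum>x\<in>UNIV. 1 - (if x \<in> Z then 1 else 0))"
    proof (intro sum.cong refl)
      fix x
      have "poly (g ^ r) x = F x ^ (2 * r)" by (simp add: power_mult g)
      moreover have "F x \<noteq> 0 \<Longrightarrow> F x ^ (2 * r) = 1"
        using power_CARD_minus_1[of "F x"] by (simp add: q)
      moreover have "F x = 0 \<longleftrightarrow> x \<in> Z" by (simp add: Z_def flip: g)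
      ultimately show "poly (g ^ r) x = 1 - (if x \<in> Z then 1 else 0)" using r by auto
    qed
    also have "\<dots> = - of_nat (card Z)"
      by (simp add: sum_subtractf of_nat_CARD_eq_0 sum.If_cases)
    finally show ?thesis using 1 by simp
  qed
  have small: "n = 0" if "of_nat n = (0::'a)" "n < 5" for n
  proof -
    have "CARD('a) \<ge> 5" using r q by simp
    thus ?thesis using that assms(1) by (auto simp: of_nat_eq_0_iff_prime_CARD dest!: dvd_imp_le)
  qed
  show ?thesis
  proof (cases "a = 0")
    case False
    hence "of_nat (card Z) \<noteq> (0::'a)" using Z by simp
    hence "Z \<noteq> {}" by auto
    then obtain x0 where x0: "poly g x0 = 0" by (auto simp: Z_def)
    define x1 where "x1 = - b / a - x0"
    have b: "b = - a * (x0 + x1)" using False by (simp add: x1_def field_simps)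
    have "c = poly g x0 - (a * x0 ^ 2 + b * x0)" by (simp add: pg)
    also have "\<dots> = - (a * x0 ^ 2 + b * x0)" by (simp only: x0 diff_0)
    also have "\<dots> = a * x0 * x1"
      unfolding b by (simp add: algebra_simps power2_eq_square)
    finally have c: "c = a * x0 * x1" .
    have fac: "poly g x = a * (x - x0) * (x - x1)" for x
      unfolding pg b c by (simp add: algebra_simps power2_eq_square)
    \<comment> \<open>Two distinct roots would give \<open>a^r = 2\<close>, while \<open>a^r\<close>
      squares to 1; then 3 would be zero in the field.\<close>
    have "x1 = x0"
    proof (rule ccontr)
      assume ne: "x1 \<noteq> x0"
      have "Z = {x0, x1}" using False by (auto simp: Z_def fac)
      hence "a ^ r = 2" using ne Z by simp
      moreover have "(a ^ r) ^ 2 = 1"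
      proof -
        have "(a ^ r) ^ 2 = a ^ (r * 2)" by (simp only: power_mult)
        also have "r * 2 = CARD('a) - 1" by (simp add: q)
        finally show ?thesis by (simp only: power_CARD_minus_1[OF False])
      qed
      ultimately have "(4::'a) - 1 = 0" by simp
      hence "of_nat 3 = (0::'a)" by simp
      from small[OF this] show False by simp
    qed
    \<comment> \<open>At \<open>x0 + 1\<close> the polynomial takes the value \<open>a\<close>, so
      \<open>a\<close> is a square.\<close>
    define d where "d = F (x0 + 1)"
    have "d ^ 2 = poly g (x0 + 1)" by (simp only: d_def g)
    also have "\<dots> = a" by (simp add: fac \<open>x1 = x0\<close>)
    finally have "a = d ^ 2" by simp
    hence "poly g x = (d * (x - x0)) ^ 2" for x
      by (simp only: fac \<open>x1 = x0\<close> power_mult_distrib power2_eq_square mult_ac)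
    thus ?thesis by blast
  next
    case True
    have "b = 0"
    proof (rule ccontr)
      assume "b \<noteq> 0"
      hence "b * x + c = 0 \<longleftrightarrow> x = - c / b" for x
        by (subst eq_divide_eq) (simp add: eq_neg_iff_add_eq_0 mult.commute)
      moreover have "Z = {x. b * x + c = 0}" by (simp add: Z_def pg True)
      ultimately have "Z = {- c / b}" by simp
      with Z True r show False by (simp add: power_0_left)
    qed
    hence "poly g x = F 0 ^ 2" for x unfolding g pg using True by simp
    thus ?thesis by blast
  qed
qed

subsection \<open>Functions with many permutation directions\<close>

lemma prime_CARD_two_neq_0:
  assumes "prime CARD('a::{field,finite})" "CARD('a) \<ge> 3"
  shows "(2::'a) \<noteq> 0"
  using of_nat_eq_0_iff_prime_CARD[OF assms(1), of 2] assms(2) by (auto dest: dvd_imp_le)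

text \<open>If \<open>F x = c\<close>, then \<open>F (x + t) = - c\<close> with
  \<open>t = 2 * c / n\<close> would produce a collision. So the value \<open>c\<close> spreads
  along all multiples of \<open>t\<close>, which fill the prime field.\<close>

lemma two_valued_plus_linear_inj_imp_const:
  fixes F :: "'a::{field,finite} \<Rightarrow> 'a"
  assumes "prime CARD('a)" "CARD('a) \<ge> 3"
    and F: "\<And>x. F x = d \<or> F x = - d" and inj: "inj (\<lambda>x. n * x + F x)"
  shows "\<exists>c. \<forall>x. F x = c"
proof (cases "d = 0")
  case True
  thus ?thesis using F by auto
next
  case d: False
  have two: "(2::'a) \<noteq> 0" using assms(1,2) by (rule prime_CARD_two_neq_0)
  define c where "c = F 0"
  have Fc: "F x = c \<or> F x = - c" for x using F[of x] F[of 0] by (auto simp: c_def)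
  have "c \<noteq> 0" using F[of 0] d by (auto simp: c_def)
  have "n \<noteq> 0"
  proof
    assume "n = 0"
    hence "inj F" using inj by simp
    hence "CARD('a) = card (range F)" by (simp add: card_image)
    also have "\<dots> \<le> card {d, - d}" using F by (intro card_mono) auto
    also have "\<dots> \<le> 2" by (simp add: card_insert_if)
    finally show False using assms(2) by simp
  qed
  define t where "t = 2 * c / n"
  have "t \<noteq> 0" using \<open>c \<noteq> 0\<close> \<open>n \<noteq> 0\<close> two by (simp add: t_def)
  have step: "F (x + t) = c" if "F x = c" for x
  proof (rule ccontr)
    assume "F (x + t) \<noteq> c"
    hence "F (x + t) = - c" using Fc by blast
    hence "n * (x + t) + F (x + t) = n * x + F x"
      using that \<open>n \<noteq> 0\<close> by (simp add: t_def algebra_simps)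
    from injD[OF inj this] show False using \<open>t \<noteq> 0\<close> by simp
  qed
  have multiples: "F (of_nat k * t) = c" for k
  proof (induction k)
    case (Suc k)
    from step[OF this] show ?case by (simp add: algebra_simps)
  qed (simp add: c_def)
  have "F x = c" for x
  proof -
    obtain k where "x / t = of_nat k" using surj_of_nat_prime_CARD[OF assms(1)] by blast
    hence "x = of_nat k * t" using \<open>t \<noteq> 0\<close> by (simp add: field_simps)
    thus ?thesis using multiples by simp
  qed
  thus ?thesis by blast
qed

lemma affine_or_two_lines:
  fixes f :: "'a::{field,finite} \<Rightarrow> 'a"
  assumes pr: "prime CARD('a)" and q: "CARD('a) = 2 * r + 1" and r: "r \<ge> 5"
    and M: "card M = r" "\<And>m. m \<in> M \<Longrightarrow> inj (\<lambda>x. x + m * f x)"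
  shows "(\<exists>a b. \<forall>x. f x = a * x + b) \<or>
    (\<exists>a1 a2 b x0. a1 \<noteq> a2 \<and> (\<forall>x. f x = b + a1 * (x - x0) \<or> f x = b + a2 * (x - x0)))"
proof -
  have two: "(2::'a) \<noteq> 0" using pr by (rule prime_CARD_two_neq_0) (use q r in simp)
  obtain m where m: "m \<in> M" "m \<noteq> 0"
  proof -
    have "\<not> M \<subseteq> {0}"
    proof
      assume "M \<subseteq> {0}"
      hence "card M \<le> card {0::'a}" by (intro card_mono) auto
      thus False using M(1) r by simp
    qed
    thus ?thesis using that by blast
  qed
  have mv: "moments_vanish f r"
    using moments_vanish_if_permutations[OF pr M(2)] M(1) q by auto
  obtain p where p: "degree p \<le> 2 * r" "\<And>x. poly p x = f x"
    using exists_interpolating_poly[of f] q by auto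
  have pf: "poly p = f" using p(2) by blast
  consider "degree p \<le> 1" | "degree p = 2" | "degree p = r + 1"
    using degree_cases_if_moments_vanish[of p r] mv q r p(1) pf by fastforce
  thus ?thesis
  proof cases
    case 1
    have "f x = coeff p 1 * x + coeff p 0" for x
    proof -
      have "poly p x = (\<Sum>i\<le>1. coeff p i * x ^ i)"
        unfolding poly_altdef using 1 by (intro sum.mono_neutral_left) (auto simp: coeff_eq_0)
      thus ?thesis by (simp add: p(2))
    qed
    thus ?thesis by blast
  next
    case 2
    with quadratic_permutation_imp_trivial[of p m] M(2)[OF m(1)] m(2) two pf show ?thesis by simp
  next
    case 3
    obtain a b g where g: "degree g \<le> 2" "\<And>x. (f x - (a * x + b)) ^ 2 = poly g x"
      using sheared_square_is_quadratic[of p r] mv q r 3 two unfolding pf by blast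
    have "r \<ge> 2" using r by simp
    from quadratic_square_valued[OF pr q this g] show ?thesis
    proof (elim disjE exE)
      fix d x0 assume d: "\<forall>x. poly g x = (d * (x - x0)) ^ 2"
      have *: "f x - (a * x + b) = d * (x - x0) \<or> f x - (a * x + b) = - (d * (x - x0))" for x
        using d g(2)[of x] by (simp add: power2_eq_iff)
      show ?thesis
      proof (cases "d = 0")
        case True
        thus ?thesis using * by (intro disjI1 exI[of _ a] exI[of _ b]) simp
      next
        case False
        have "a + d \<noteq> a - d"
        proof
          assume "a + d = a - d"
          hence "2 * d = 0" by (simp add: algebra_simps)
          thus False using two False by simp
        qed
        moreover have "f x = (a * x0 + b) + (a + d) * (x - x0) \<or> f x = (a * x0 + b) + (a - d) * (x - x0)" for x
          using *[of x] by (simp add: algebra_simps)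
        ultimately show ?thesis by blast
      qed
    next
      fix d assume d: "\<forall>x. poly g x = d ^ 2"
      define F where "F = (\<lambda>x. f x - (a * x + b))"
      have *: "F x = d \<or> F x = - d" for x
        using d g(2)[of x] by (simp add: power2_eq_iff F_def)
      \<comment> \<open>Here the graph lies on two parallel lines. Up to an additive constant the
        map is \<open>(x + m * f x) / m\<close>, so its injectivity collapses the two lines to
        one.\<close>
      have "inj (\<lambda>x. (1 + m * a) / m * x + F x)"
      proof (rule injI)
        fix x y assume eq: "(1 + m * a) / m * x + F x = (1 + m * a) / m * y + F y"
        have "m * ((1 + m * a) / m * z + F z) + m * b = z + m * f z" for z
          using m(2) by (simp add: F_def field_simps)
        with eq have "x + m * f x = y + m * f y" by metis
        thus "x = y" using injD[OF M(2)[OF m(1)]] by blast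
      qed
      from two_valued_plus_linear_inj_imp_const[OF pr _ * this]
      obtain c where "\<forall>x. F x = c" using q r by auto
      hence "f x = a * x + (b + c)" for x by (simp add: F_def algebra_simps)
      thus ?thesis by blast
    qed
  qed
qed

section \<open>Graphs on two intersecting lines\<close>

text \<open>The ratios \<open>v / u\<close> of points on the two lines avoid the ratios coming from \<open>M\<close>. Counting
  forces equality throughout, so that the set of ratios is a translate \<open>V / u\<close> for every \<open>u\<close> and
  is therefore invariant under multiplication by \<open>u' / u\<close>.\<close>

lemma two_lines_direction_symmetry:
  fixes f :: "'a::{field,finite} \<Rightarrow> 'a"
  assumes q: "CARD('a) = 2 * r + 1" and r: "r \<ge> 2"
    and M: "card M = r" "\<And>m. m \<in> M \<Longrightarrow> inj (\<lambda>x. x + m * f x)"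
    and a: "a1 \<noteq> a2" and f: "\<And>x. f x = b + a1 * (x - x0) \<or> f x = b + a2 * (x - x0)"
    and not_affine: "\<not> (\<exists>a b. \<forall>x. f x = a * x + b)"
  shows "\<exists>W h. h \<noteq> 0 \<and> h \<noteq> 1 \<and> (\<forall>w. h * w \<in> W \<longleftrightarrow> w \<in> W) \<and>
    (\<forall>m. m \<in> M \<longleftrightarrow> 1 + m * a1 \<noteq> 0 \<and> 1 + m * a2 \<noteq> 0 \<and> (1 + m * a1) / (1 + m * a2) \<in> W) \<and>
    (\<forall>w\<in>W. \<exists>m. 1 + m * a2 \<noteq> 0 \<and> w = (1 + m * a1) / (1 + m * a2))"
proof -
  \<comment> \<open>Positions on the two lines are measured from their common point
    \<open>(x0, b)\<close>; leaving out 0 makes \<open>U\<close> and \<open>V\<close>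
    disjoint.\<close>
  define U where "U = {u. u \<noteq> 0 \<and> f (x0 + u) = b + a1 * u}"
  define V where "V = {v. v \<noteq> 0 \<and> f (x0 + v) = b + a2 * v}"
  define R where "R = {v / u | u v. u \<in> U \<and> v \<in> V}"
  define W where "W = (UNIV - {0}) - R"
  \<comment> \<open>A collision of \<open>x0 + u\<close> with \<open>x0 + v\<close> means
    \<open>u * (1 + m * a1) = v * (1 + m * a2)\<close>, that is,
    \<open>\<phi> m = v / u\<close>.\<close>
  define \<phi> where "\<phi> = (\<lambda>m. (1 + m * a1) / (1 + m * a2))"
  have f0: "f x0 = b" using f[of x0] by simp
  have fin: "finite A" for A :: "'a set" by (rule finite)
  have UV: "U \<union> V = UNIV - {0}" "U \<inter> V = {}"
    using f[of "x0 + _"] a by (auto simp: U_def V_def)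
  have U: "U \<noteq> {}"
  proof
    assume "U = {}"
    have "f x = a2 * x + (b - a2 * x0)" for x
    proof (cases "x = x0")
      case False
      hence "x - x0 \<in> V" using UV(1) \<open>U = {}\<close> by auto
      thus ?thesis by (simp add: V_def algebra_simps)
    qed (simp add: f0)
    thus False using not_affine by blast
  qed
  have V: "V \<noteq> {}"
  proof
    assume "V = {}"
    have "f x = a1 * x + (b - a1 * x0)" for x
    proof (cases "x = x0")
      case False
      hence "x - x0 \<in> U" using UV(1) \<open>V = {}\<close> by auto
      thus ?thesis by (simp add: U_def algebra_simps)
    qed (simp add: f0)
    thus False using not_affine by blast
  qed
  have nz1: "1 + m * a1 \<noteq> 0" if "m \<in> M" for m
  proof
    assume *: "1 + m * a1 = 0"
    obtain u where u: "u \<in> U" using U by blast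
    have "(x0 + u) + m * f (x0 + u) = x0 + m * f x0 + u * (1 + m * a1)"
      using u by (simp add: U_def f0 algebra_simps)
    hence "x0 + u = x0" using injD[OF M(2)[OF that], of "x0 + u" x0] * by simp
    thus False using u by (simp add: U_def)
  qed
  have nz2: "1 + m * a2 \<noteq> 0" if "m \<in> M" for m
  proof
    assume *: "1 + m * a2 = 0"
    obtain v where v: "v \<in> V" using V by blast
    have "(x0 + v) + m * f (x0 + v) = x0 + m * f x0 + v * (1 + m * a2)"
      using v by (simp add: V_def f0 algebra_simps)
    hence "x0 + v = x0" using injD[OF M(2)[OF that], of "x0 + v" x0] * by simp
    thus False using v by (simp add: V_def)
  qed
  have \<phi>_R: "\<phi> m \<notin> R" if "m \<in> M" for m
  proof
    assume "\<phi> m \<in> R"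
    then obtain u v where uv: "u \<in> U" "v \<in> V" "\<phi> m = v / u" by (auto simp: R_def)
    hence "u \<noteq> 0" by (simp add: U_def)
    with uv(3) nz2[OF that] have "u * (1 + m * a1) = v * (1 + m * a2)"
      by (simp add: \<phi>_def frac_eq_eq mult.commute)
    hence "(x0 + u) + m * f (x0 + u) = (x0 + v) + m * f (x0 + v)"
      using uv(1,2) by (simp add: U_def V_def algebra_simps)
    from injD[OF M(2)[OF that] this] have "u = v" by simp
    thus False using uv UV(2) by blast
  qed
  have \<phi>_inj: "m = m'" if "\<phi> m = \<phi> m'" "1 + m * a2 \<noteq> 0" "1 + m' * a2 \<noteq> 0" for m m'
  proof -
    have "(1 + m * a1) * (1 + m' * a2) = (1 + m' * a1) * (1 + m * a2)"
      using that by (simp add: \<phi>_def frac_eq_eq)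
    hence "(m - m') * (a1 - a2) = 0" by (simp add: algebra_simps)
    thus ?thesis using a by simp
  qed
  have "inj_on \<phi> M" using \<phi>_inj nz2 by (auto intro: inj_onI)
  hence card_\<phi>: "card (\<phi> ` M) = r" using M(1) by (simp add: card_image)
  have \<phi>_W: "\<phi> ` M \<subseteq> W" using \<phi>_R nz1 nz2 by (auto simp: W_def \<phi>_def)
  hence "r \<le> card W" using card_mono[OF fin \<phi>_W] card_\<phi> by simp
  moreover have R0: "R \<subseteq> UNIV - {0}" by (auto simp: R_def U_def V_def)
  hence "card W = 2 * r - card R" "card R \<le> 2 * r"
    using card_mono[OF fin R0] q by (auto simp: W_def card_Diff_subset fin)
  ultimately have card_R: "card R \<le> r" by linarith
  have VR: "(\<lambda>v. v / u) ` V \<subseteq> R" "card ((\<lambda>v. v / u) ` V) = card V" if "u \<in> U" for u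
    using that by (auto simp: R_def U_def intro!: card_image inj_onI)
  have UR: "(\<lambda>u. v / u) ` U \<subseteq> R" "card ((\<lambda>u. v / u) ` U) = card U" if "v \<in> V" for v
    using that by (auto simp: R_def V_def intro!: card_image inj_onI)
  have "card V \<le> r"
    using U card_mono[OF fin VR(1)] VR(2) card_R by (metis ex_in_conv order_trans)
  moreover have "card U \<le> r"
    using V card_mono[OF fin UR(1)] UR(2) card_R by (metis ex_in_conv order_trans)
  moreover have "card U + card V = 2 * r"
    using card_Un_disjoint[OF fin fin UV(2)] q by (simp add: UV(1))
  ultimately have cards: "card U = r" "card V = r" by linarith+
  have R_eq: "R = (\<lambda>v. v / u) ` V" if "u \<in> U" for u
    using VR[OF that] cards card_R by (intro card_seteq[symmetric] fin) auto
  obtain u0 where "u0 \<in> U" using U by blast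
  hence "card R = r" using VR(2)[of u0] R_eq[of u0] cards by simp
  hence "card W = r" using \<open>card W = 2 * r - card R\<close> by linarith
  hence W_eq: "\<phi> ` M = W" by (intro card_seteq[OF fin \<phi>_W]) (simp add: card_\<phi>)
  obtain u u' where u: "u \<in> U" "u' \<in> U" "u \<noteq> u'"
  proof -
    obtain u where "u \<in> U" using U by blast
    have "\<not> U \<subseteq> {u}"
    proof
      assume "U \<subseteq> {u}"
      from card_mono[OF fin this] show False using cards r by simp
    qed
    thus ?thesis using that \<open>u \<in> U\<close> by blast
  qed
  hence nz: "u \<noteq> 0" "u' \<noteq> 0" by (auto simp: U_def)
  define h where "h = u' / u"
  have "h \<noteq> 0" "h \<noteq> 1" using nz u by (auto simp: h_def)
  have "h * w \<in> R \<longleftrightarrow> w \<in> R" for w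
  proof -
    have "h * w \<in> R \<longleftrightarrow> (\<exists>v\<in>V. h * w = v / u)" by (auto simp: R_eq[OF u(1)])
    also have "\<dots> \<longleftrightarrow> (\<exists>v\<in>V. w = v / u')"
      using nz by (intro bex_cong refl) (auto simp: h_def eq_divide_eq mult.commute)
    also have "\<dots> \<longleftrightarrow> w \<in> R" by (auto simp: R_eq[OF u(2)])
    finally show ?thesis .
  qed
  hence "h * w \<in> W \<longleftrightarrow> w \<in> W" for w using \<open>h \<noteq> 0\<close> by (simp add: W_def)
  moreover have "m \<in> M \<longleftrightarrow> 1 + m * a1 \<noteq> 0 \<and> 1 + m * a2 \<noteq> 0 \<and> \<phi> m \<in> W" for m
  proof
    assume "m \<in> M"
    thus "1 + m * a1 \<noteq> 0 \<and> 1 + m * a2 \<noteq> 0 \<and> \<phi> m \<in> W" using nz1 nz2 \<phi>_W by blast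
  next
    assume *: "1 + m * a1 \<noteq> 0 \<and> 1 + m * a2 \<noteq> 0 \<and> \<phi> m \<in> W"
    then obtain m' where "m' \<in> M" "\<phi> m = \<phi> m'" unfolding W_eq[symmetric] by blast
    thus "m \<in> M" using \<phi>_inj[of m m'] nz2 * by blast
  qed
  moreover have "\<exists>m. 1 + m * a2 \<noteq> 0 \<and> w = \<phi> m" if "w \<in> W" for w
  proof -
    have "w \<in> \<phi> ` M" using that by (simp only: W_eq)
    then obtain m where "m \<in> M" "w = \<phi> m" by (rule imageE)
    thus ?thesis using nz2 by blast
  qed
  ultimately show ?thesis
    using \<open>h \<noteq> 0\<close> \<open>h \<noteq> 1\<close> unfolding \<phi>_def
    by - (rule exI[of _ W], rule exI[of _ h], intro conjI allI ballI, (assumption | blast)+)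
qed

subsection \<open>Linear symmetries of the slope set\<close>

text \<open>Adjacency is expressed by two independent linear forms. If it is unchanged when the
  first form is scaled by \<open>h\<close>, the linear map that scales this form and keeps the other
  is an automorphism fixing the origin, yet no homothety.\<close>

lemma no_nonscalar_symmetry:
  fixes S :: "'a::{field,finite} set"
  assumes stab: "{f. GS_aut S f \<and> f (0, 0) = (0, 0)} = {(\<lambda>(x, y). (l * x, l * y)) | l. l \<noteq> 0}"
    and det: "p1 * q2 - p2 * q1 \<noteq> 0" and h: "h \<noteq> 0" "h \<noteq> 1"
    and S: "\<And>x y. x \<noteq> 0 \<and> y * inverse x \<in> S \<longleftrightarrow> \<Phi> (p1 * x + q1 * y) (p2 * x + q2 * y)"
    and \<Phi>: "\<And>a b. \<Phi> (h * a) b \<longleftrightarrow> \<Phi> a b"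
  shows False
proof -
  define D where "D = p1 * q2 - p2 * q1"
  define l1 l2 where "l1 = (\<lambda>v. p1 * fst v + q1 * snd v)" and "l2 = (\<lambda>v. p2 * fst v + q2 * snd v)"
  define k where "k = (\<lambda>v. (h - 1) / D * l1 v)"
  \<comment> \<open>The vector \<open>(q2, - p2)\<close> spans the kernel of \<open>l2\<close> and
    has \<open>l1\<close>-value \<open>D\<close>; the factor \<open>k v\<close> is chosen so that
    \<open>l1\<close> is multiplied by \<open>h\<close>.\<close>
  define T where "T = (\<lambda>v. (fst v + k v * q2, snd v - k v * p2))"
  have D: "D \<noteq> 0" using det by (simp add: D_def)
  have T1: "l1 (T v) = h * l1 v" for v
  proof -
    have "l1 (T v) = l1 v + k v * D"
      by (simp add: T_def l1_def D_def algebra_simps)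
    also have "k v * D = (h - 1) * l1 v" using D by (simp add: k_def)
    also have "l1 v + (h - 1) * l1 v = h * l1 v" by (simp add: algebra_simps)
    finally show ?thesis .
  qed
  have T2: "l2 (T v) = l2 v" for v
    by (simp add: T_def l2_def algebra_simps)
  have l_inj: "u = v" if "l1 u = l1 v" "l2 u = l2 v" for u v
  proof -
    have "D * fst w = q2 * l1 w - q1 * l2 w" "D * snd w = p1 * l2 w - p2 * l1 w" for w
      by (simp_all add: D_def l1_def l2_def algebra_simps)
    hence "D * fst u = D * fst v" "D * snd u = D * snd v" using that by simp_all
    thus ?thesis using D by (simp add: prod_eq_iff)
  qed
  have "inj T"
  proof (rule injI)
    fix u v assume "T u = T v"
    hence "h * l1 u = h * l1 v" "l2 u = l2 v" unfolding T1[symmetric] T2[symmetric, of u] T2[symmetric, of v] by simp_all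
    thus "u = v" using h by (intro l_inj) auto
  qed
  hence "bij T" by (simp add: bij_def finite_UNIV_inj_surj)
  have adj: "GS_adj S u v \<longleftrightarrow> \<Phi> (l1 v - l1 u) (l2 v - l2 u)" for u v
  proof -
    have "GS_adj S u v \<longleftrightarrow> fst v - fst u \<noteq> 0 \<and> (snd v - snd u) * inverse (fst v - fst u) \<in> S"
      by (auto simp: GS_adj_def)
    also have "\<dots> \<longleftrightarrow> \<Phi> (l1 v - l1 u) (l2 v - l2 u)"
      unfolding S by (simp add: l1_def l2_def algebra_simps)
    finally show ?thesis .
  qed
  have "GS_aut S T"
    unfolding GS_aut_def adj T1 T2 using \<open>bij T\<close> by (simp add: \<Phi> flip: right_diff_distrib)
  moreover have "T (0, 0) = (0, 0)" by (simp add: T_def k_def l1_def)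
  ultimately have "T \<in> {(\<lambda>(x, y). (l * x, l * y)) | l. l \<noteq> 0}"
    unfolding stab[symmetric] by simp
  then obtain l where l: "T = (\<lambda>(x, y). (l * x, l * y))" by blast
  have "l2 (T v) = l * l2 v" "l1 (T v) = l * l1 v" for v
    by (simp_all add: l l1_def l2_def case_prod_unfold algebra_simps)
  hence eq: "l2 v = l * l2 v" "h * l1 v = l * l1 v" for v
    unfolding T1 T2 .
  define w1 w2 where "w1 = (q2 / D, - p2 / D)" and "w2 = (- q1 / D, p1 / D)"
  have "l1 w1 = 1"
    using D by (simp add: l1_def w1_def flip: add_divide_distrib diff_divide_distrib) (simp add: D_def mult.commute)
  moreover have "l2 w2 = 1"
    using D by (simp add: l2_def w2_def flip: add_divide_distrib diff_divide_distrib) (simp add: D_def mult.commute)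
  ultimately have "l = 1" "h = l" using eq(1)[of w2] eq(2)[of w1] by auto
  thus False using h by simp
qed

text \<open>With at most three slopes, negating a suitable linear form preserves the slope set: one
  or two slopes are fixed individually, and of three one is fixed while the other two are
  swapped.\<close>

lemma card_slopes_gt_3:
  fixes S :: "'a::{field,finite} set"
  assumes stab: "{f. GS_aut S f \<and> f (0, 0) = (0, 0)} = {(\<lambda>(x, y). (l * x, l * y)) | l. l \<noteq> 0}"
    and two: "(2::'a) \<noteq> 0" and "S \<noteq> {}"
  shows "card S > 3"
proof (rule ccontr)
  assume "\<not> card S > 3"
  moreover have "card S \<noteq> 0" using \<open>S \<noteq> {}\<close> by simp
  ultimately have "card S = 1 \<or> card S = 2 \<or> card S = 3" by linarith
  moreover have neg1: "(-1::'a) \<noteq> 1"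
  proof
    assume "(-1::'a) = 1"
    hence "(2::'a) = 0" using eq_neg_iff_add_eq_0[of 1 "1::'a"] by simp
    thus False using two by simp
  qed
  have slope: "y * inverse x = s \<longleftrightarrow> y = s * x" if "x \<noteq> 0" for x y s :: 'a
    using that by (simp add: divide_eq_eq flip: divide_inverse)
  ultimately consider s where "S = {s}" | s t where "S = {s, t}" "s \<noteq> t"
    | s t u where "S = {s, t, u}" "s \<noteq> t" "s \<noteq> u" "t \<noteq> u"
    by (auto simp: card_1_singleton_iff card_2_iff card_3_iff)
  thus False
  proof cases
    case (1 s)
    show False
    proof (rule no_nonscalar_symmetry[OF stab, where h = "-1" and ?p1.0 = "-s" and ?q1.0 = 1
          and ?p2.0 = 1 and ?q2.0 = 0 and \<Phi> = "\<lambda>a b. a = 0 \<and> b \<noteq> 0"])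
      show "x \<noteq> 0 \<and> y * inverse x \<in> S \<longleftrightarrow> - s * x + 1 * y = 0 \<and> 1 * x + 0 * y \<noteq> 0" for x y
        using slope[of x y s] by (auto simp: 1)
    qed (use neg1 in auto)
  next
    case (2 s t)
    show False
    proof (rule no_nonscalar_symmetry[OF stab, where h = "-1" and ?p1.0 = "-s" and ?q1.0 = 1
          and ?p2.0 = "-t" and ?q2.0 = 1 and \<Phi> = "\<lambda>a b. (a = 0) \<noteq> (b = 0)"])
      show "x \<noteq> 0 \<and> y * inverse x \<in> S \<longleftrightarrow> (- s * x + 1 * y = 0) \<noteq> (- t * x + 1 * y = 0)" for x y
        using slope[of x y s] slope[of x y t] 2(2) by (cases "x = 0") (auto simp: 2(1))
    qed (use neg1 2(2) in auto)
  next
    case (3 s t u)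
    \<comment> \<open>The forms are the difference and the sum of
      \<open>(t - u) * (y - s * x)\<close> and \<open>(s - u) * (y - t * x)\<close>. Then slope
      \<open>u\<close> is \<open>a = 0\<close>, slope \<open>t\<close> is \<open>a = b\<close> and
      slope \<open>s\<close> is \<open>a = - b\<close>.\<close>
    let ?p1 = "- u * (t - s)" and ?q1 = "t - s"
    let ?p2 = "- (s * (t - u) + t * (s - u))" and ?q2 = "(t - u) + (s - u)"
    show False
    proof (rule no_nonscalar_symmetry[OF stab, where h = "-1" and ?p1.0 = ?p1 and ?q1.0 = ?q1
          and ?p2.0 = ?p2 and ?q2.0 = ?q2
          and \<Phi> = "\<lambda>a b. (a = 0 \<and> b \<noteq> 0) \<or> (a \<noteq> 0 \<and> (a = b \<or> a = - b))"])
      have "?p1 * ?q2 - ?p2 * ?q1 = 2 * ((t - s) * (s - u) * (t - u))"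
        by (simp add: algebra_simps)
      thus "?p1 * ?q2 - ?p2 * ?q1 \<noteq> 0" using two 3 by simp
    next
      fix x y
      let ?a = "?p1 * x + ?q1 * y" and ?b = "?p2 * x + ?q2 * y"
      have "?a = (t - s) * (y - u * x)" by (simp add: algebra_simps)
      hence A: "?a = 0 \<longleftrightarrow> y = u * x" using 3 by simp
      have "?a - ?b = - 2 * ((s - u) * (y - t * x))" by (simp add: algebra_simps)
      hence "?a - ?b = 0 \<longleftrightarrow> y = t * x" using 3 two by simp
      hence B: "?a = ?b \<longleftrightarrow> y = t * x" by simp
      have "?a + ?b = 2 * ((t - u) * (y - s * x))" by (simp add: algebra_simps)
      hence "?a + ?b = 0 \<longleftrightarrow> y = s * x" using 3 two by simp
      hence C: "?a = - ?b \<longleftrightarrow> y = s * x" by (simp only: eq_neg_iff_add_eq_0)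
      have E: "?b = 2 * ((s - u) * (u - t) * x)" if "y = u * x"
        unfolding that by (simp add: algebra_simps)
      hence E: "?b = 0 \<longleftrightarrow> x = 0" if "y = u * x" using 3 two that by simp
      show "x \<noteq> 0 \<and> y * inverse x \<in> S \<longleftrightarrow> (?a = 0 \<and> ?b \<noteq> 0) \<or> (?a \<noteq> 0 \<and> (?a = ?b \<or> ?a = - ?b))"
        unfolding A B C
        using E slope[of x y s] slope[of x y t] slope[of x y u] by (cases "x = 0") (auto simp: 3(1))
    next
      fix a b :: 'a
      have "- a = b \<longleftrightarrow> a = - b" by auto
      thus "(-1 * a = 0 \<and> b \<noteq> 0) \<or> (-1 * a \<noteq> 0 \<and> (-1 * a = b \<or> -1 * a = - b)) \<longleftrightarrow>
          (a = 0 \<and> b \<noteq> 0) \<or> (a \<noteq> 0 \<and> (a = b \<or> a = - b))"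
        unfolding mult_minus1 neg_equal_0_iff_equal neg_equal_iff_equal by blast
    qed (use neg1 in simp_all)
  qed
qed

text \<open>A non-affine \<open>f\<close> has its graph on two lines, and the invariance of
  \<open>W\<close> under \<open>h\<close> then scales one of two linear forms while preserving
  adjacency, which the stabilizer forbids.\<close>

lemma transversal_function_affine:
  fixes S :: "'a::{field,finite} set"
  assumes pr: "prime CARD('a)" and ge: "CARD('a) \<ge> 3" and cS: "card S = (CARD('a) - 1) div 2"
    and stab: "{f. GS_aut S f \<and> f (0, 0) = (0, 0)} = {(\<lambda>(x, y). (l * x, l * y)) | l. l \<noteq> 0}"
    and inj: "\<And>s. s \<in> S \<Longrightarrow> inj (\<lambda>x. x + (s0 - s) * f x)"
  shows "\<exists>a b. \<forall>x. f x = a * x + b"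
proof (rule ccontr)
  assume not_affine: "\<not> ?thesis"
  define r where "r = card S"
  have "odd CARD('a)" using pr ge prime_odd_nat by fastforce
  hence q: "CARD('a) = 2 * r + 1" unfolding r_def cS by presburger
  have "r > 3"
    unfolding r_def using stab prime_CARD_two_neq_0[OF pr ge]
  proof (rule card_slopes_gt_3)
    show "S \<noteq> {}" using q ge r_def by auto
  qed
  moreover have "r \<noteq> 4"
  proof
    assume "r = 4"
    hence q9: "CARD('a) = 9" by (simp add: q)
    have "\<And>m. m dvd CARD('a) \<Longrightarrow> m = 1 \<or> m = CARD('a)" using pr by (simp only: prime_nat_iff)
    from this[of 3] show False by (simp add: q9)
  qed
  ultimately have r: "r \<ge> 5" by simp
  define M where "M = (\<lambda>s. s0 - s) ` S"
  have cM: "card M = r" unfolding M_def r_def by (intro card_image) (auto intro: inj_onI)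
  have M: "inj (\<lambda>x. x + m * f x)" if "m \<in> M" for m
    using that inj by (auto simp: M_def)
  obtain a1 a2 b x0 where a: "a1 \<noteq> a2" "\<And>x. f x = b + a1 * (x - x0) \<or> f x = b + a2 * (x - x0)"
    using affine_or_two_lines[OF pr q r cM M] not_affine by blast
  have r2: "r \<ge> 2" using r by simp
  obtain W h where h: "h \<noteq> 0" "h \<noteq> 1" and W: "\<And>w. h * w \<in> W \<longleftrightarrow> w \<in> W"
    and MW: "\<And>m. m \<in> M \<longleftrightarrow> 1 + m * a1 \<noteq> 0 \<and> 1 + m * a2 \<noteq> 0 \<and> (1 + m * a1) / (1 + m * a2) \<in> W"
    and finite_slope: "\<And>w. w \<in> W \<Longrightarrow> \<exists>m. 1 + m * a2 \<noteq> 0 \<and> w = (1 + m * a1) / (1 + m * a2)"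
    using two_lines_direction_symmetry[OF q r2 cM M a not_affine] by blast
  show False
  proof (rule no_nonscalar_symmetry[OF stab _ h, where ?p1.0 = "1 + a1 * s0" and ?q1.0 = "- a1"
        and ?p2.0 = "1 + a2 * s0" and ?q2.0 = "- a2" and \<Phi> = "\<lambda>a b. a \<noteq> 0 \<and> b \<noteq> 0 \<and> a / b \<in> W"])
    show "(1 + a1 * s0) * - a2 - (1 + a2 * s0) * - a1 \<noteq> 0"
      using a(1) by (simp add: algebra_simps)
    show "h * a \<noteq> 0 \<and> b \<noteq> 0 \<and> h * a / b \<in> W \<longleftrightarrow> a \<noteq> 0 \<and> b \<noteq> 0 \<and> a / b \<in> W" for a b
      using h(1) W[of "a / b"] by simp
    fix x y
    show "x \<noteq> 0 \<and> y * inverse x \<in> S \<longleftrightarrow> (1 + a1 * s0) * x + - a1 * y \<noteq> 0 \<and>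
      (1 + a2 * s0) * x + - a2 * y \<noteq> 0 \<and>
      ((1 + a1 * s0) * x + - a1 * y) / ((1 + a2 * s0) * x + - a2 * y) \<in> W"
    proof (cases "x = 0")
      case True
      \<comment> \<open>Vertical vectors are not edge directions, so their ratio
        \<open>a1 / a2\<close> must avoid \<open>W\<close>; no finite \<open>m\<close> attains it
        because \<open>a1 \<noteq> a2\<close>.\<close>
      have "a1 / a2 \<notin> W" if "a2 \<noteq> 0"
      proof
        assume "a1 / a2 \<in> W"
        then obtain m where "1 + m * a2 \<noteq> 0" "a1 / a2 = (1 + m * a1) / (1 + m * a2)"
          using finite_slope by blast
        hence "a1 * (1 + m * a2) = (1 + m * a1) * a2" using that by (simp add: frac_eq_eq)
        thus False using a(1) by (simp add: algebra_simps)
      qed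
      thus ?thesis using True by auto
    next
      case False
      define m where "m = s0 - y * inverse x"
      have "(1 + c * s0) * x + - c * y = x * (1 + m * c)" for c
        using False by (simp add: m_def algebra_simps)
      moreover have "y * inverse x \<in> S \<longleftrightarrow> m \<in> M"
        by (auto simp: m_def M_def)
      ultimately show ?thesis using False MW[of m] by simp
    qed
  qed
qed

subsection \<open>Colourings\<close>

lemma GS_aut_translate: "GS_aut S (\<lambda>v. (fst v + a, snd v + b))"
proof -
  have "bij (\<lambda>v. (fst v + a, snd v + b))"
    by (rule bij_betw_byWitness[where f' = "\<lambda>v. (fst v - a, snd v - b)"]) auto
  thus ?thesis by (auto simp: GS_aut_def GS_adj_def)
qed

lemma not_distinguishing_if_le_CARD_colors:
  fixes S :: "'a::{field,finite} set"
  assumes pr: "prime CARD('a)" and ge: "CARD('a) \<ge> 3" and cS: "card S = (CARD('a) - 1) div 2"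
    and stab: "{f. GS_aut S f \<and> f (0, 0) = (0, 0)} = {(\<lambda>(x, y). (l * x, l * y)) | l. l \<noteq> 0}"
    and c: "\<And>v. c v < CARD('a)" and proper: "proper_col (GS_adj S) c"
  shows "\<not> distinguishing_col (GS_aut S) c"
proof
  assume dist: "distinguishing_col (GS_aut S) c"
  have "card S \<noteq> 0" using ge cS by linarith
  then obtain s0 where s0: "s0 \<in> S" by fastforce
  have slope: "c (x, z + s * x) \<noteq> c (x', z + s * x')" if "s \<in> S" "x \<noteq> x'" for s x x' z
  proof -
    have "((z + s * x') - (z + s * x)) * inverse (x' - x) = s"
      using that(2) by (simp add: field_simps)
    hence "GS_adj S (x, z + s * x) (x', z + s * x')"
      using that by (simp add: GS_adj_def)
    thus ?thesis using proper by (simp add: proper_col_def)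
  qed
  \<comment> \<open>A line of slope \<open>s0\<close> has \<open>q\<close> points of distinct
    colours, so with \<open>q\<close> colours each one occurs on it.\<close>
  have ex: "\<exists>x. c (x, X + s0 * x) = i" if "i < CARD('a)" for i X
  proof -
    have "inj (\<lambda>x. c (x, X + s0 * x))" using slope[OF s0] by (intro injI) blast
    hence "range (\<lambda>x. c (x, X + s0 * x)) = {..<CARD('a)}"
      using c by (intro card_subset_eq) (auto simp: card_image)
    hence "i \<in> range (\<lambda>x. c (x, X + s0 * x))" using that by simp
    thus ?thesis by auto
  qed
  define f where "f = (\<lambda>i X. SOME x. c (x, X + s0 * x) = i)"
  have f: "c (f i X, X + s0 * f i X) = i" if "i < CARD('a)" for i X
    unfolding f_def using someI_ex[OF ex[OF that]] .
  have class_iff: "c (x, X + s0 * x) = i \<longleftrightarrow> x = f i X" if "i < CARD('a)" for i x X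
    using f[OF that, of X] slope[OF s0, of x "f i X" X] by auto
  have "\<exists>a b. \<forall>X. f i X = a * X + b" if i: "i < CARD('a)" for i
  proof (rule transversal_function_affine[OF pr ge cS stab])
    fix s assume s: "s \<in> S"
    show "inj (\<lambda>X. X + (s0 - s) * f i X)"
    proof (rule injI)
      fix X Y assume eq: "X + (s0 - s) * f i X = Y + (s0 - s) * f i Y"
      \<comment> \<open>This is the intercept of the line of slope \<open>s\<close> through the
        point of colour \<open>i\<close> at \<open>X\<close>. Equal intercepts put two points of one
        colour on a line of slope \<open>s\<close>, so they coincide.\<close>
      define z where "z = X + (s0 - s) * f i X"
      have "X + s0 * f i X = z + s * f i X" by (simp add: z_def algebra_simps)
      moreover have "Y + s0 * f i Y = z + s * f i Y"
        unfolding z_def eq by (simp add: algebra_simps)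
      ultimately have "f i X = f i Y"
        using slope[OF s, of "f i X" "f i Y" z] f[OF i, of X] f[OF i, of Y] by metis
      with eq show "X = Y" by simp
    qed
  qed
  then obtain a b where ab: "\<And>i X. i < CARD('a) \<Longrightarrow> f i X = a i * X + b i" by metis
  \<comment> \<open>Non-parallel classes would meet in a point carrying two colours.\<close>
  have parallel: "a i = a 0" if i: "i < CARD('a)" for i
  proof (rule ccontr)
    assume ne: "a i \<noteq> a 0"
    have 0: "0 < CARD('a)" using ge by simp
    define X where "X = (b 0 - b i) / (a i - a 0)"
    have "(a i - a 0) * X = b 0 - b i" using ne by (simp add: X_def)
    hence "f i X = f 0 X" using ab[OF i] ab[OF 0] by (simp add: algebra_simps)
    hence "i = 0" using f[OF i, of X] f[OF 0, of X] by metis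
    thus False using ne by simp
  qed
  \<comment> \<open>Raising \<open>X\<close> by 1 along a class moves \<open>x\<close> by
    \<open>a 0\<close> and \<open>y = X + s0 * x\<close> by \<open>1 + s0 * a 0\<close>. These two
    shifts are never both zero.\<close>
  define T where "T = (\<lambda>v. (fst v + a 0, snd v + (1 + s0 * a 0)))"
  have cT: "c (T v) = c v" for v
  proof -
    define i where "i = c v"
    have i: "i < CARD('a)" using c by (simp add: i_def)
    obtain x X where v: "v = (x, X + s0 * x)"
      by (metis add_diff_cancel_left' diff_add_cancel prod.exhaust_sel)
    have "x = a 0 * X + b i"
      using class_iff[OF i, of x X] ab[OF i] parallel[OF i] by (simp add: v i_def)
    hence "x + a 0 = f i (X + 1)" using ab[OF i] parallel[OF i] by (simp add: algebra_simps)
    hence "c (x + a 0, (X + 1) + s0 * (x + a 0)) = i" using class_iff[OF i] by blast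
    thus ?thesis by (simp add: T_def v i_def algebra_simps)
  qed
  have aut: "GS_aut S T" unfolding T_def by (rule GS_aut_translate)
  hence "surj T" by (simp add: GS_aut_def bij_is_surj)
  have "T ` {v. c v = i} = {v. c v = i}" for i
  proof (intro subset_antisym subsetI)
    fix v assume v: "v \<in> {v. c v = i}"
    obtain w where "v = T w" using \<open>surj T\<close> by (metis surjD)
    thus "v \<in> T ` {v. c v = i}" using v cT by auto
  qed (use cT in auto)
  hence "T = id" using dist aut by (simp add: distinguishing_col_def)
  hence "T (0, 0) = (0, 0)" by simp
  thus False by (auto simp: T_def)
qed

lemma exists_distinguishing_col:
  fixes S :: "'a::{field,finite} set"
  assumes stab: "{f. GS_aut S f \<and> f (0, 0) = (0, 0)} = {(\<lambda>(x, y). (l * x, l * y)) | l. l \<noteq> 0}"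
  shows "\<exists>c. (\<forall>v. c v < CARD('a) + 1) \<and> proper_col (GS_adj S) c \<and> distinguishing_col (GS_aut S) c"
proof -
  obtain e :: "'a \<Rightarrow> nat" where e: "bij_betw e UNIV {0..<CARD('a)}"
    using ex_bij_betw_finite_nat[of "UNIV :: 'a set"] by auto
  hence e_inj: "e x = e y \<longleftrightarrow> x = y" and e_less: "e x < CARD('a)" for x y
    by (auto simp: bij_betw_def inj_eq)
  define c where "c = (\<lambda>v :: 'a \<times> 'a. if v = (0, 0) then CARD('a) else e (fst v))"
  have c0: "c v = CARD('a) \<longleftrightarrow> v = (0, 0)" for v
    using e_less[of "fst v"] by (auto simp: c_def)
  have "proper_col (GS_adj S) c"
    using e_less by (auto simp: proper_col_def GS_adj_def c_def e_inj less_imp_neq dest: less_imp_neq[symmetric])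
  moreover have "distinguishing_col (GS_aut S) c"
    unfolding distinguishing_col_def
  proof (intro allI impI)
    fix f assume *: "GS_aut S f \<and> (\<forall>i. f ` {v. c v = i} = {v. c v = i})"
    have cf: "c (f v) = c v" for v using * by blast
    have "f (0, 0) = (0, 0)" using cf[of "(0, 0)"] c0 by metis
    hence "f \<in> {(\<lambda>(x, y). (l * x, l * y)) | l. l \<noteq> 0}" unfolding stab[symmetric] using * by simp
    then obtain l where l: "f = (\<lambda>(x, y). (l * x, l * y))" "l \<noteq> 0" by blast
    \<comment> \<open>Since \<open>l \<noteq> 0\<close>, the image \<open>(l, 0)\<close> of
      \<open>(1, 0)\<close> is not the origin, so its colour reveals \<open>l\<close>.\<close>
    have "e l = e 1" using cf[of "(1, 0)"] l by (simp add: c_def)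
    thus "f = id" by (auto simp: l(1) e_inj)
  qed
  moreover have "c v < CARD('a) + 1" for v
    using e_less[of "fst v"] by (auto simp: c_def)
  ultimately show ?thesis by blast
qed

theorem mainTheorem11:
  fixes S :: "'a::{field,finite} set"
  assumes "prime CARD('a)"
    and "CARD('a) \<ge> 3"
    and "card S = (CARD('a) - 1) div 2"
    and "{f. GS_aut S f \<and> f (0, 0) = (0, 0)}
           = {(\<lambda>(x, y). (l * x, l * y)) | l. l \<noteq> 0}"
  shows "chi_D_GS S = CARD('a) + 1"
  unfolding chi_D_GS_def
proof (rule Least_equality)
  show "\<exists>c. (\<forall>v. c v < CARD('a) + 1) \<and> proper_col (GS_adj S) c \<and> distinguishing_col (GS_aut S) c"
    by (rule exists_distinguishing_col[OF assms(4)])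
next
  fix k assume "\<exists>c. (\<forall>v. c v < k) \<and> proper_col (GS_adj S) c \<and> distinguishing_col (GS_aut S) c"
  then obtain c where c: "\<And>v. c v < k" "proper_col (GS_adj S) c" "distinguishing_col (GS_aut S) c"
    by blast
  show "CARD('a) + 1 \<le> k"
  proof (rule ccontr)
    assume "\<not> CARD('a) + 1 \<le> k"
    hence "c v < CARD('a)" for v using c(1)[of v] by linarith
    from not_distinguishing_if_le_CARD_colors[OF assms this c(2)] c(3) show False by blast
  qed
qed

end
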